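(* Let $r,s$ be positive integers whose greatest common divisor $d=\gcd(r,s)$ satisfies $d\neq 1$, and let $G=\mathbb{Z}_r\oplus\mathbb{Z}_s$. For each integer $c\geq 2$, let $\mathcal{N}_c$ be the variety of nilpotent groups of class at most $c$. Then for every $c\geq 2$, $G$ does not admit any $\mathcal{N}_c$-stem cover, and so $G$ has no $\mathcal{N}_c$-covering group.
   Context: $\mathbb{Z}_m$ denotes the cyclic group of order $m$. The lower central series of a group $H$ is $\gamma_1(H)=H$, $\gamma_{i+1}(H)=[\gamma_i(H),H]$, and $Z_c(H)$ denotes the $c$-th term of the upper central series of $H$ ($Z_0(H)=1$, $Z_{i+1}(H)/Z_i(H)=Z(H/Z_i(H))$). For a normal subgroup $R$ of a group $F$, $[R,\,_0F]=R$ and $[R,\,_{i}F]=[[R,\,_{i-1}F],F]$ for $i\ge 1$. Baer-invariant: let $1\to R\to F\to G\to 1$ be a free presentation of a group $G$ (so $F$ is a free group and $F/R\cong G$). The Baer-invariant of $G$ with respect to the variety $\mathcal{N}_c$ of nilpotent groups of class at most $c$ is $$\mathcal{N}_cM(G)=\frac{R\cap\gamma_{c+1}(F)}{[R,\,_cF]};$$ up to isomorphism it is independent of the chosen free presentation. Stem covers: for the variety $\mathcal{N}_c$, the verbal subgroup of a group $H$ is $\gamma_{c+1}(H)$ and the marginal subgroup is $Z_c(H)$. An $\mathcal{N}_c$-stem cover of a group $G$ is an exact sequence of groups $1\to A\to G^*\to G\to 1$ such that (identifying $A$ with its image in $G^*$) $A\subseteq\gamma_{c+1}(G^* )\cap Z_c(G^*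 )$ and $A\cong\mathcal{N}_cM(G)$. In this case $G^*$ is called an $\mathcal{N}_c$-covering group of $G$. *)

theory Defs
  imports "HOL-Algebra.Elementary_Groups"
begin

section \<open>Commutators and central series\<close>

text \<open>The subgroup $[H,K]$ generated by all commutators of elements of \<open>H\<close> with elements of \<open>K\<close>,
  with the commutator convention of the library's \<open>derived\<close>
  (so that \<open>derived G H = commutator_subgroup G H H\<close>).\<close>

definition commutator_subgroup :: "('a, 'b) monoid_scheme \<Rightarrow> 'a set \<Rightarrow> 'a set \<Rightarrow> 'a set" where
  "commutator_subgroup G H K =
     generate G (\<Union>h \<in> H. \<Union>k \<in> K. {h \<otimes>\<^bsub>G\<^esub> k \<otimes>\<^bsub>G\<^esub> inv\<^bsub>G\<^esub> h \<otimes>\<^bsub>G\<^esub> inv\<^bsub>G\<^esub> k})"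

text \<open>\<open>iterated_commutator G R i\<close> is $[R,\,_i G]$.\<close>

primrec iterated_commutator :: "('a, 'b) monoid_scheme \<Rightarrow> 'a set \<Rightarrow> nat \<Rightarrow> 'a set" where
  "iterated_commutator G R 0 = R"
| "iterated_commutator G R (Suc i) = commutator_subgroup G (iterated_commutator G R i) (carrier G)"

text \<open>The series is indexed from 1, i.e. \<open>lower_central G 1 = carrier G\<close>; the value at 0 is a dummy.\<close>

fun lower_central :: "('a, 'b) monoid_scheme \<Rightarrow> nat \<Rightarrow> 'a set" where
  "lower_central G 0 = carrier G"
| "lower_central G (Suc 0) = carrier G"
| "lower_central G (Suc (Suc i)) = commutator_subgroup G (lower_central G (Suc i)) (carrier G)"

definition group_center :: "('a, 'b) monoid_scheme \<Rightarrow> 'a set" where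
  "group_center G = {z \<in> carrier G. \<forall>x \<in> carrier G. z \<otimes>\<^bsub>G\<^esub> x = x \<otimes>\<^bsub>G\<^esub> z}"

text \<open>$Z_{i+1}(G)$ is the preimage in \<open>G\<close> of the centre of $G/Z_i(G)$.\<close>

primrec upper_central :: "('a, 'b) monoid_scheme \<Rightarrow> nat \<Rightarrow> 'a set" where
  "upper_central G 0 = {\<one>\<^bsub>G\<^esub>}"
| "upper_central G (Suc i) =
     {x \<in> carrier G. upper_central G i #>\<^bsub>G\<^esub> x \<in> group_center (G Mod upper_central G i)}"


section \<open>Free groups\<close>

text \<open>A word is a list of letters \<open>(x, e)\<close>, where \<open>(x, True)\<close> stands for \<open>x\<close> and \<open>(x, False)\<close>
  for the inverse of \<open>x\<close>.\<close>

primrec word_value :: "('a, 'b) monoid_scheme \<Rightarrow> ('a \<times> bool) list \<Rightarrow> 'a" where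
  "word_value G [] = \<one>\<^bsub>G\<^esub>"
| "word_value G (l # w) = (if snd l then fst l else inv\<^bsub>G\<^esub> (fst l)) \<otimes>\<^bsub>G\<^esub> word_value G w"

definition reduced_word :: "('a \<times> bool) list \<Rightarrow> bool" where
  "reduced_word w \<longleftrightarrow> successively (\<lambda>l m. \<not> (fst l = fst m \<and> snd l \<noteq> snd m)) w"

text \<open>\<open>G\<close> is free on \<open>X\<close> if every element of \<open>G\<close> is the value of exactly one reduced word over \<open>X\<close>.
  A universal property cannot quantify over groups on arbitrary types inside a definition; it is
  derived from this definition, for target groups of every type, in \<open>free_on_universal\<close> below.\<close>

definition free_on :: "('a, 'b) monoid_scheme \<Rightarrow> 'a set \<Rightarrow> bool" where
  "free_on G X \<longleftrightarrow> group G \<and> X \<subseteq> carrier G \<and>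
     bij_betw (word_value G) {w \<in> lists (X \<times> UNIV). reduced_word w} (carrier G)"

definition free_group :: "('a, 'b) monoid_scheme \<Rightarrow> bool" where
  "free_group G \<longleftrightarrow> (\<exists>X. free_on G X)"

lemma (in group) word_value_closed:
  "w \<in> lists (carrier G \<times> UNIV) \<Longrightarrow> word_value G w \<in> carrier G"
  by (induction w) auto

lemma (in group) word_value_append:
  "u \<in> lists (carrier G \<times> UNIV) \<Longrightarrow> v \<in> lists (carrier G \<times> UNIV) \<Longrightarrow>
   word_value G (u @ v) = word_value G u \<otimes> word_value G v"
proof (induction u)
  case (Cons l u)
  then show ?case
    using word_value_closed[of u] word_value_closed[of v] by (auto simp: m_assoc)
qed (auto simp: word_value_closed)

lemma map_word_in_lists:
  "f \<in> X \<rightarrow> Y \<Longrightarrow> w \<in> lists (X \<times> UNIV) \<Longrightarrow> map (apfst f) w \<in> lists (Y \<times> UNIV)"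
  by (induction w) auto

lemma (in group) word_value_cancel:
  assumes "f \<in> X \<rightarrow> carrier G" "w \<in> lists (X \<times> UNIV)" "x \<in> X"
  shows "word_value G (map (apfst f) ((x, e) # (x, \<not> e) # w)) = word_value G (map (apfst f) w)"
proof -
  have "word_value G (map (apfst f) w) \<in> carrier G" "f x \<in> carrier G"
    using assms map_word_in_lists word_value_closed by (fast, fast)
  then show ?thesis
    by (cases e) (auto simp: m_assoc[symmetric])
qed

lemma reduced_word_exists:
  assumes "group G" "X \<subseteq> carrier G" "group H" "f \<in> X \<rightarrow> carrier H" "w \<in> lists (X \<times> UNIV)"
  shows "\<exists>v \<in> lists (X \<times> UNIV). reduced_word v \<and> word_value G v = word_value G w \<and>
           word_value H (map (apfst f) v) = word_value H (map (apfst f) w)"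
  using assms(5)
proof (induction w)
  case Nil
  show ?case by (rule bexI[of _ "[]"]) (auto simp: reduced_word_def)
next
  case (Cons l w)
  obtain x e where l: "l = (x, e)" by (cases l)
  have x: "x \<in> X" using Cons l by auto
  obtain v where v: "v \<in> lists (X \<times> UNIV)" "reduced_word v" "word_value G v = word_value G w"
    "word_value H (map (apfst f) v) = word_value H (map (apfst f) w)"
    using Cons by auto
  show ?case
  proof (cases "\<exists>t. v = (x, \<not> e) # t")
    case True
    then obtain t where t: "v = (x, \<not> e) # t" by blast
    have tX: "t \<in> lists (X \<times> UNIV)" using v t by auto
    have "reduced_word t"
      using v(2) t by (cases t) (auto simp: reduced_word_def)
    moreover have "word_value H (map (apfst f) t) = word_value H (map (apfst f) (l # w))"
      using group.word_value_cancel[OF assms(3,4) tX x, of e] v(4) t l by simp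
    moreover have "word_value G t = word_value G (l # w)"
    proof -
      have "map (apfst id) u = u" for u :: "('a \<times> bool) list"
        by (induction u) auto
      moreover have "id \<in> X \<rightarrow> carrier G" using assms(2) by auto
      ultimately have "word_value G t = word_value G ((x, e) # v)"
        using group.word_value_cancel[OF assms(1) _ tX x, of id e] t by metis
      then show ?thesis using v(3) l by simp
    qed
    ultimately show ?thesis using tX by blast
  next
    case False
    then have "reduced_word (l # v)"
      using v(2) l by (cases v) (auto simp: reduced_word_def)
    then show ?thesis
      using v l x by (intro bexI[of _ "l # v"]) auto
  qed
qed

lemma hom_word_value:
  assumes "group G" "group H" "h \<in> hom G H" "w \<in> lists (carrier G \<times> UNIV)"
  shows "h (word_value G w) = word_value H (map (apfst h) w)"
proof -
  interpret group_hom G H h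
    using assms by (simp add: group_hom_def group_hom_axioms_def)
  show ?thesis
    using assms(4)
  proof (induction w)
    case (Cons l w)
    then have "word_value G w \<in> carrier G" by (intro G.word_value_closed) simp
    then show ?case using Cons by auto
  qed auto
qed

lemma free_on_universal:
  assumes F: "free_on F X" and H: "group H" and f: "f \<in> X \<rightarrow> carrier H"
  shows "\<exists>h \<in> hom F H. \<forall>x \<in> X. h x = f x"
    and "\<lbrakk>g \<in> hom F H; \<forall>x \<in> X. g x = f x; h \<in> hom F H; \<forall>x \<in> X. h x = f x; a \<in> carrier F\<rbrakk>
         \<Longrightarrow> g a = h a"
proof -
  interpret F: group F using F by (simp add: free_on_def)
  interpret H: group H by (rule H)
  let ?W = "{w \<in> lists (X \<times> UNIV). reduced_word w}"
  have X: "X \<subseteq> carrier F" and bij: "bij_betw (word_value F) ?W (carrier F)"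
    using F by (auto simp: free_on_def)
  have XF: "w \<in> lists (carrier F \<times> UNIV)" if "w \<in> lists (X \<times> UNIV)" for w
    using that X by auto
  define nf where "nf = inv_into ?W (word_value F)"
  have nf: "nf a \<in> ?W" "word_value F (nf a) = a" if "a \<in> carrier F" for a
    using inv_into_into[of a "word_value F" ?W] f_inv_into_f[of a "word_value F" ?W] that bij
    unfolding nf_def bij_betw_def by (simp_all only:)
  have nf_eq: "nf (word_value F w) = w" if "w \<in> ?W" for w
    using that bij unfolding nf_def by (meson bij_betw_def inv_into_f_f)
  define h where "h = (\<lambda>a. word_value H (map (apfst f) (nf a)))"
  have "h \<in> hom F H"
  proof (rule homI)
    fix a assume a: "a \<in> carrier F"
    show "h a \<in> carrier H"
      using nf(1)[OF a] map_word_in_lists[OF f] unfolding h_def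
      by (intro H.word_value_closed) blast
  next
    fix a b assume a: "a \<in> carrier F" and b: "b \<in> carrier F"
    have ab: "nf a \<in> lists (X \<times> UNIV)" "nf b \<in> lists (X \<times> UNIV)"
      using nf(1) a b by blast+
    then have "nf a @ nf b \<in> lists (X \<times> UNIV)" by simp
    from reduced_word_exists[OF F.is_group X H f this] obtain v where
      v: "v \<in> ?W" "word_value F v = word_value F (nf a @ nf b)"
         "word_value H (map (apfst f) v) = word_value H (map (apfst f) (nf a @ nf b))"
      by blast
    have "word_value F v = a \<otimes>\<^bsub>F\<^esub> b"
      using v(2) F.word_value_append[OF XF[OF ab(1)] XF[OF ab(2)]] nf(2) a b by simp
    then have "nf (a \<otimes>\<^bsub>F\<^esub> b) = v" using nf_eq[OF v(1)] by simp
    then show "h (a \<otimes>\<^bsub>F\<^esub> b) = h a \<otimes>\<^bsub>H\<^esub> h b"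
      using v(3) H.word_value_append[OF map_word_in_lists[OF f ab(1)] map_word_in_lists[OF f ab(2)]]
      unfolding h_def by simp
  qed
  moreover have "h x = f x" if "x \<in> X" for x
  proof -
    have "[(x, True)] \<in> ?W" using that by (simp add: reduced_word_def)
    from nf_eq[OF this] have "nf x = [(x, True)]" using that X by auto
    moreover have "f x \<in> carrier H" using that f by auto
    ultimately show ?thesis unfolding h_def by simp
  qed
  ultimately show "\<exists>h \<in> hom F H. \<forall>x \<in> X. h x = f x" by blast
next
  assume g: "g \<in> hom F H" "\<forall>x \<in> X. g x = f x" and h: "h \<in> hom F H" "\<forall>x \<in> X. h x = f x"
    and a: "a \<in> carrier F"
  have grp: "group F" and X: "X \<subseteq> carrier F" using F by (auto simp: free_on_def)
  obtain w where w: "w \<in> lists (X \<times> UNIV)" "a = word_value F w"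
    using F a unfolding free_on_def bij_betw_def by blast
  have "map (apfst g) w = map (apfst h) w"
    using w(1) g(2) h(2) by auto
  moreover have "w \<in> lists (carrier F \<times> UNIV)"
    using w(1) X by auto
  ultimately show "g a = h a"
    using hom_word_value[OF grp H g(1), of w] hom_word_value[OF grp H h(1), of w] w(2) by metis
qed


section \<open>Baer invariants and stem covers\<close>

text \<open>A free presentation $1 \to R \to F \to G \to 1$ is given by an epimorphism \<open>\<pi>\<close> from a free
  group \<open>F\<close> onto \<open>G\<close>; then \<open>R = kernel F G \<pi>\<close>.\<close>

definition free_presentation ::
    "('f, 'm) monoid_scheme \<Rightarrow> ('f \<Rightarrow> 'g) \<Rightarrow> ('g, 'n) monoid_scheme \<Rightarrow> bool" where
  "free_presentation F \<pi> G \<longleftrightarrow> free_group F \<and> group G \<and> \<pi> \<in> epi F G"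

text \<open>The Baer invariant of \<open>G\<close> for the variety of nilpotent groups of class at most \<open>c\<close>, computed
  from the presentation \<open>\<pi>\<close>. Up to isomorphism it does not depend on \<open>\<pi>\<close>; rather than singling out
  one presentation, the presentation is kept as a parameter here and below.\<close>

definition baer_invariant ::
    "nat \<Rightarrow> ('f, 'm) monoid_scheme \<Rightarrow> ('f \<Rightarrow> 'g) \<Rightarrow> ('g, 'n) monoid_scheme \<Rightarrow> 'f set monoid" where
  "baer_invariant c F \<pi> G =
     (F\<lparr>carrier := kernel F G \<pi> \<inter> lower_central F (c + 1)\<rparr>)
       Mod iterated_commutator F (kernel F G \<pi>) c"

text \<open>The library's \<open>short_exact_sequence\<close> forces all groups to live on the same type.\<close>

definition group_extension ::
    "('a, 'k) monoid_scheme \<Rightarrow> ('a \<Rightarrow> 'e) \<Rightarrow> ('e, 'm) monoid_scheme \<Rightarrow> ('e \<Rightarrow> 'g) \<Rightarrow>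
     ('g, 'n) monoid_scheme \<Rightarrow> bool" where
  "group_extension A \<iota> E p G \<longleftrightarrow> group A \<and> group E \<and> group G \<and>
     \<iota> \<in> mon A E \<and> p \<in> epi E G \<and> \<iota> ` carrier A = kernel E G p"

definition stem_cover ::
    "nat \<Rightarrow> ('f, 'l) monoid_scheme \<Rightarrow> ('f \<Rightarrow> 'g) \<Rightarrow>
     ('a, 'k) monoid_scheme \<Rightarrow> ('a \<Rightarrow> 'e) \<Rightarrow> ('e, 'm) monoid_scheme \<Rightarrow> ('e \<Rightarrow> 'g) \<Rightarrow>
     ('g, 'n) monoid_scheme \<Rightarrow> bool" where
  "stem_cover c F \<pi> A \<iota> E p G \<longleftrightarrow> group_extension A \<iota> E p G \<and>
     \<iota> ` carrier A \<subseteq> lower_central E (c + 1) \<inter> upper_central E c \<and>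
     A \<cong> baer_invariant c F \<pi> G"

text \<open>Since \<open>\<iota>\<close> is injective, \<open>A\<close> may be replaced by its image in \<open>E\<close>, so it is no restriction to
  take \<open>A\<close> on the carrier type of \<open>E\<close>.\<close>

definition covering_group ::
    "nat \<Rightarrow> ('f, 'l) monoid_scheme \<Rightarrow> ('f \<Rightarrow> 'g) \<Rightarrow> ('g, 'n) monoid_scheme \<Rightarrow>
     ('e, 'm) monoid_scheme \<Rightarrow> bool" where
  "covering_group c F \<pi> G E \<longleftrightarrow>
     (\<exists>(A :: 'e monoid) \<iota> p. stem_cover c F \<pi> A \<iota> E p G)"

end

theory Submission
  imports Defs "HOL-Computational_Algebra.Formal_Power_Series" "HOL-Number_Theory.Cong"
begin

text \<open>If \<open>E\<close> were a covering group of the abelian group \<open>G\<close> with kernel \<open>A\<close>, then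
  $\gamma_2(E) \subseteq A \subseteq \gamma_{c+1}(E) \subseteq \gamma_3(E)$ since $c \ge 2$, while \<open>E\<close> is
  nilpotent because $A \subseteq Z_c(E)$. Hence $\gamma_2(E) = 1$, so \<open>A\<close> and with it the Baer invariant
  would be trivial, that is $\gamma_{c+1}(F) \subseteq [R,\,_c F]$.

  To refute this, map \<open>F\<close> to the semidirect product of the integers, generated by \<open>t\<close>, with power series,
  where \<open>t\<close> acts as multiplication by $1+X$, so that the generators of \<open>G\<close> lift to \<open>t\<close> and to the series 1
  modulo \<open>d = gcd r s\<close>. Elements $t^k v$ of the image of \<open>R\<close> have \<open>k\<close> and $v_0$ divisible by \<open>d\<close>. Since
  $(1+X)^k - 1 = kX + \cdots$, each further commutator raises the order in \<open>X\<close> by one and keeps the leading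
  coefficient divisible by \<open>d\<close>, whereas the commutator $[a, b, \ldots, b]$ of lifts of the two generators
  has a leading coefficient coprime to \<open>d\<close>.\<close>

unbundle fps_syntax

section \<open>Commutator subgroups and the lower central series\<close>

lemma (in group) commutator_closed:
  "x \<in> carrier G \<Longrightarrow> y \<in> carrier G \<Longrightarrow> x \<otimes> y \<otimes> inv x \<otimes> inv y \<in> carrier G"
  by simp

lemma (in group) commutator_generators_subset:
  assumes "H \<subseteq> carrier G" "K \<subseteq> carrier G"
  shows "(\<Union>h \<in> H. \<Union>k \<in> K. {h \<otimes> k \<otimes> inv h \<otimes> inv k}) \<subseteq> carrier G"
  using assms by (auto intro!: commutator_closed)

lemma (in group) commutator_subgroup_is_subgroup:
  assumes "H \<subseteq> carrier G" "K \<subseteq> carrier G"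
  shows "subgroup (commutator_subgroup G H K) G"
  unfolding commutator_subgroup_def
  by (rule generate_is_subgroup[OF commutator_generators_subset[OF assms]])

lemma commutator_in_commutator_subgroup:
  assumes "h \<in> H" "k \<in> K"
  shows "h \<otimes>\<^bsub>G\<^esub> k \<otimes>\<^bsub>G\<^esub> inv\<^bsub>G\<^esub> h \<otimes>\<^bsub>G\<^esub> inv\<^bsub>G\<^esub> k \<in> commutator_subgroup G H K"
  unfolding commutator_subgroup_def using assms by (intro generate.incl) blast

lemma (in group) commutator_subgroup_minimal:
  assumes "subgroup N G"
    and "\<And>h k. h \<in> H \<Longrightarrow> k \<in> K \<Longrightarrow> h \<otimes> k \<otimes> inv h \<otimes> inv k \<in> N"
  shows "commutator_subgroup G H K \<subseteq> N"
  unfolding commutator_subgroup_def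
  using assms(2) by (intro generate_subgroup_incl[OF _ assms(1)]) blast

lemma (in group) commutator_subgroup_mono:
  assumes "H \<subseteq> H'"
  shows "commutator_subgroup G H K \<subseteq> commutator_subgroup G H' K"
  unfolding commutator_subgroup_def using assms by (intro mono_generate) blast

lemma (in group) lower_central_subgroup: "subgroup (lower_central G n) G"
proof (induction n)
  case (Suc n)
  then show ?case
    by (cases n) (auto intro: subgroup_self commutator_subgroup_is_subgroup dest: subgroup.subset)
qed (simp add: subgroup_self)

lemma (in group) lower_central_subset: "lower_central G n \<subseteq> carrier G"
  by (rule subgroup.subset[OF lower_central_subgroup])

lemma (in group) lower_central_subset_2:
  assumes "2 \<le> n"
  shows "lower_central G n \<subseteq> lower_central G 2"
proof -
  obtain m where "n = Suc (Suc m)"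
    using assms by (metis add_2_eq_Suc le_Suc_ex)
  then show ?thesis
    using commutator_subgroup_mono[OF lower_central_subset] by (simp add: numeral_2_eq_2)
qed

text \<open>The bound is gamma_3 with one commutator step unfolded, which is the shape that
  \<open>trivial_if_perfect_in_upper_central\<close> consumes for H = gamma_2.\<close>

lemma (in group) lower_central_subset_3:
  assumes "3 \<le> n"
  shows "lower_central G n \<subseteq> commutator_subgroup G (lower_central G 2) (carrier G)"
proof -
  obtain m where n: "n = Suc (Suc (Suc m))"
    using assms by (metis Suc_le_D numeral_3_eq_3 Suc_le_mono)
  have "lower_central G (Suc (Suc m)) \<subseteq> lower_central G 2"
    by (rule lower_central_subset_2) simp
  then show ?thesis
    unfolding n lower_central.simps by (rule commutator_subgroup_mono)
qed

lemma (in group) iterated_commutator_subset: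
  "R \<subseteq> carrier G \<Longrightarrow> iterated_commutator G R i \<subseteq> carrier G"
  by (induction i)
    (auto dest!: subgroup.subset[OF commutator_subgroup_is_subgroup[OF _ subset_refl]])

lemma (in group) one_in_iterated_commutator:
  "\<one> \<in> R \<Longrightarrow> \<one> \<in> iterated_commutator G R i"
  by (cases i) (auto simp: commutator_subgroup_def generate.one)

section \<open>Centres of quotients and the upper central series\<close>

lemma (in group) mult_inv_cancel:
  assumes "x \<in> carrier G" "y \<in> carrier G"
  shows "x \<otimes> (inv x \<otimes> y) = y" and "inv x \<otimes> (x \<otimes> y) = y"
  using assms by (simp_all flip: m_assoc)

lemma (in normal) rcos_commute_iff:
  assumes x: "x \<in> carrier G" and y: "y \<in> carrier G"
  shows "H #> (x \<otimes> y) = H #> (y \<otimes> x) \<longleftrightarrow> x \<otimes> y \<otimes> inv x \<otimes> inv y \<in> H"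
proof -
  have "H #> (x \<otimes> y) = H #> (y \<otimes> x) \<longleftrightarrow> x \<otimes> y \<in> H #> (y \<otimes> x)"
    using x y repr_independence[of "x \<otimes> y" H "y \<otimes> x"] rcos_self[of "x \<otimes> y" H]
      subgroup_axioms by auto
  also have "\<dots> \<longleftrightarrow> x \<otimes> y \<otimes> inv (y \<otimes> x) \<in> H"
    using x y by (intro rcos_module is_group) auto
  also have "x \<otimes> y \<otimes> inv (y \<otimes> x) = x \<otimes> y \<otimes> inv x \<otimes> inv y"
    using x y by (simp add: inv_mult_group m_assoc)
  finally show ?thesis .
qed

lemma (in normal) preimage_center_iff:
  "x \<in> carrier G \<and> H #> x \<in> group_center (G Mod H) \<longleftrightarrow>
   x \<in> carrier G \<and> (\<forall>y \<in> carrier G. x \<otimes> y \<otimes> inv x \<otimes> inv y \<in> H)"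
proof (rule conj_cong[OF refl])
  assume x: "x \<in> carrier G"
  have "H #> x \<in> group_center (G Mod H) \<longleftrightarrow>
     (\<forall>y \<in> carrier G. (H #> x) <#> (H #> y) = (H #> y) <#> (H #> x))"
    using x by (auto simp: group_center_def FactGroup_def RCOSETS_def)
  also have "\<dots> \<longleftrightarrow> (\<forall>y \<in> carrier G. H #> (x \<otimes> y) = H #> (y \<otimes> x))"
    using x by (auto simp: rcos_sum)
  also have "\<dots> \<longleftrightarrow> (\<forall>y \<in> carrier G. x \<otimes> y \<otimes> inv x \<otimes> inv y \<in> H)"
    using x by (auto simp: rcos_commute_iff)
  finally show "H #> x \<in> group_center (G Mod H) \<longleftrightarrow>
     (\<forall>y \<in> carrier G. x \<otimes> y \<otimes> inv x \<otimes> inv y \<in> H)" .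
qed

text \<open>With [x, y] = x y x^-1 y^-1, the closure properties rest on [ab, y] = a [b, y] a^-1
  [a, y], on [a^-1, y] = a^-1 [a, y]^-1 a and on [g a g^-1, y] = g [a, g^-1 y g] g^-1; conjugates
  stay in \<open>H\<close> by normality.\<close>

lemma (in normal) normal_preimage_center:
  "{x \<in> carrier G. \<forall>y \<in> carrier G. x \<otimes> y \<otimes> inv x \<otimes> inv y \<in> H} \<lhd> G"
    (is "?Z \<lhd> G")
proof (rule normal_invI)
  show "subgroup ?Z G"
  proof
    show "?Z \<subseteq> carrier G" by auto
    show "\<one> \<in> ?Z" by simp
  next
    fix a b assume a: "a \<in> ?Z" and b: "b \<in> ?Z"
    have "a \<otimes> b \<otimes> y \<otimes> inv (a \<otimes> b) \<otimes> inv y \<in> H" if y: "y \<in> carrier G" for y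
    proof -
      have "a \<otimes> (b \<otimes> y \<otimes> inv b \<otimes> inv y) \<otimes> inv a \<otimes> (a \<otimes> y \<otimes> inv a \<otimes> inv y) \<in> H"
        using a b y by (auto intro!: m_closed inv_op_closed2)
      also have "a \<otimes> (b \<otimes> y \<otimes> inv b \<otimes> inv y) \<otimes> inv a \<otimes> (a \<otimes> y \<otimes> inv a \<otimes> inv y)
          = a \<otimes> b \<otimes> y \<otimes> inv (a \<otimes> b) \<otimes> inv y"
        using a b y by (simp add: inv_mult_group m_assoc mult_inv_cancel)
      finally show ?thesis .
    qed
    then show "a \<otimes> b \<in> ?Z" using a b by auto
  next
    fix a assume a: "a \<in> ?Z"
    have "inv a \<otimes> y \<otimes> inv (inv a) \<otimes> inv y \<in> H" if y: "y \<in> carrier G" for y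
    proof -
      have "inv a \<otimes> inv (a \<otimes> y \<otimes> inv a \<otimes> inv y) \<otimes> a \<in> H"
        using a y by (auto intro!: inv_op_closed1)
      also have "inv a \<otimes> inv (a \<otimes> y \<otimes> inv a \<otimes> inv y) \<otimes> a
          = inv a \<otimes> y \<otimes> inv (inv a) \<otimes> inv y"
        using a y by (simp add: inv_mult_group m_assoc mult_inv_cancel)
      finally show ?thesis .
    qed
    then show "inv a \<in> ?Z" using a by auto
  qed
next
  fix g a assume g: "g \<in> carrier G" and a: "a \<in> ?Z"
  have "g \<otimes> a \<otimes> inv g \<otimes> y \<otimes> inv (g \<otimes> a \<otimes> inv g) \<otimes> inv y \<in> H" if y: "y \<in> carrier G" for y
  proof -
    let ?y = "inv g \<otimes> y \<otimes> g"
    have "g \<otimes> (a \<otimes> ?y \<otimes> inv a \<otimes> inv ?y) \<otimes> inv g \<in> H"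
      using a y g by (auto intro!: inv_op_closed2)
    also have "g \<otimes> (a \<otimes> ?y \<otimes> inv a \<otimes> inv ?y) \<otimes> inv g
        = g \<otimes> a \<otimes> inv g \<otimes> y \<otimes> inv (g \<otimes> a \<otimes> inv g) \<otimes> inv y"
      using a y g by (simp add: inv_mult_group m_assoc mult_inv_cancel)
    finally show ?thesis .
  qed
  then show "g \<otimes> a \<otimes> inv g \<in> ?Z" using a g by auto
qed

text \<open>Normality at stage i makes the quotient used at stage i + 1 a group, so that commuting
  cosets can be replaced by commutators and \<open>normal_preimage_center\<close> applies.\<close>

lemma (in group) upper_central_normal: "upper_central G i \<lhd> G"
proof (induction i)
  case 0
  show ?case by (simp add: one_is_normal)
next
  case (Suc i)
  interpret normal "upper_central G i" G by (rule Suc)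
  show ?case using normal_preimage_center by (simp add: preimage_center_iff)
qed

lemma (in group) upper_central_Suc:
  "upper_central G (Suc i) =
     {x \<in> carrier G. \<forall>y \<in> carrier G. x \<otimes> y \<otimes> inv x \<otimes> inv y \<in> upper_central G i}"
  using normal.preimage_center_iff[OF upper_central_normal] by simp

text \<open>Commutators of elements of Z_{i+1} with the whole group fall into Z_i. A set contained
  in its own commutator subgroup therefore slides down the upper central series to Z_0.\<close>

lemma (in group) trivial_if_perfect_in_upper_central:
  assumes "H \<subseteq> commutator_subgroup G H (carrier G)" "H \<subseteq> upper_central G i"
  shows "H \<subseteq> {\<one>}"
  using assms(2)
proof (induction i)
  case (Suc i)
  have "commutator_subgroup G H (carrier G) \<subseteq> upper_central G i"
    using Suc.prems unfolding upper_central_Suc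
    by (intro commutator_subgroup_minimal normal_imp_subgroup upper_central_normal) auto
  then show ?case using Suc.IH assms(1) by blast
qed simp

section \<open>Stem covers of abelian groups have trivial kernel\<close>

lemma (in group_hom) lower_central_2_subset_kernel:
  assumes "comm_group H"
  shows "lower_central G 2 \<subseteq> kernel G H h"
proof -
  interpret H: comm_group H by (rule assms)
  have "h (x \<otimes>\<^bsub>G\<^esub> y \<otimes>\<^bsub>G\<^esub> inv\<^bsub>G\<^esub> x \<otimes>\<^bsub>G\<^esub> inv\<^bsub>G\<^esub> y) = \<one>\<^bsub>H\<^esub>"
    if "x \<in> carrier G" "y \<in> carrier G" for x y
  proof -
    have "h x \<otimes>\<^bsub>H\<^esub> h y \<otimes>\<^bsub>H\<^esub> inv\<^bsub>H\<^esub> h x = h y \<otimes>\<^bsub>H\<^esub> h x \<otimes>\<^bsub>H\<^esub> inv\<^bsub>H\<^esub> h x"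
      using that by (simp add: H.m_comm)
    also have "\<dots> = h y" using that by (simp add: H.m_assoc)
    finally show ?thesis using that by simp
  qed
  then have "commutator_subgroup G (carrier G) (carrier G) \<subseteq> kernel G H h"
    by (intro G.commutator_subgroup_minimal subgroup_kernel) (auto simp: kernel_def)
  then show ?thesis by (simp add: numeral_2_eq_2)
qed

lemma stem_cover_of_abelian_trivial:
  assumes cover: "stem_cover c F \<pi> A \<iota> E p G" and "comm_group G" "2 \<le> c"
  shows "carrier A = {\<one>\<^bsub>A\<^esub>}"
proof -
  have A: "group A" and E: "group E" and G: "group G" and \<iota>: "\<iota> \<in> mon A E" and p: "p \<in> epi E G"
    and im: "\<iota> ` carrier A = kernel E G p"
    and low: "\<iota> ` carrier A \<subseteq> lower_central E (c + 1)"
    and up: "\<iota> ` carrier A \<subseteq> upper_central E c"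
    using cover by (auto simp: stem_cover_def group_extension_def)
  interpret A: group A by (rule A)
  interpret E: group E by (rule E)
  interpret p: group_hom E G p
    using E G p by (simp add: group_hom_def group_hom_axioms_def epi_def)
  interpret \<iota>: group_hom A E \<iota>
    using A E \<iota> by (simp add: group_hom_def group_hom_axioms_def mon_def)
  have ker: "lower_central E 2 \<subseteq> \<iota> ` carrier A"
    unfolding im by (rule p.lower_central_2_subset_kernel[OF assms(2)])
  have "lower_central E (c + 1) \<subseteq> commutator_subgroup E (lower_central E 2) (carrier E)"
    using assms(3) by (intro E.lower_central_subset_3) simp
  \<comment> \<open>Both hypotheses of the descent hold for gamma_2(E): it lies in the image of
    \<open>A\<close>, hence in gamma_{c+1}(E) and so in [gamma_2(E), E], and also in Z_c(E). The
    bound on \<open>c\<close> enters through c + 1 being at least 3.\<close>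
  then have "lower_central E 2 \<subseteq> {\<one>\<^bsub>E\<^esub>}"
    using ker low up by (intro E.trivial_if_perfect_in_upper_central[of _ c]) blast+
  then have "\<iota> ` carrier A \<subseteq> {\<one>\<^bsub>E\<^esub>}"
    using low E.lower_central_subset_2[of "c + 1"] assms(3) by auto
  moreover have "inj_on \<iota> (carrier A)" using \<iota> by (simp add: mon_def)
  ultimately have "x = \<one>\<^bsub>A\<^esub>" if "x \<in> carrier A" for x
    using that by (intro inj_onD[of \<iota> "carrier A" x]) auto
  then show ?thesis by auto
qed

text \<open>A quotient with a one-point carrier has a single coset. The coset of \<open>x\<close>
  then equals that of the identity, which is \<open>?T\<close> itself, and \<open>x\<close> lies in
  its own coset.\<close>

lemma baer_invariant_trivialD:
  assumes "group F" "group G" "\<pi> \<in> hom F G"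
    and A: "A \<cong> baer_invariant c F \<pi> G" "carrier A = {a}"
  shows "kernel F G \<pi> \<inter> lower_central F (c + 1) \<subseteq> iterated_commutator F (kernel F G \<pi>) c"
proof
  interpret group_hom F G \<pi>
    using assms by (simp add: group_hom_def group_hom_axioms_def)
  let ?R = "kernel F G \<pi>"
  let ?S = "?R \<inter> lower_central F (c + 1)"
  let ?T = "iterated_commutator F ?R c"
  fix x assume x: "x \<in> ?S"
  have sub: "subgroup ?S F"
    by (intro G.subgroups_Inter_pair subgroup_kernel G.lower_central_subgroup)
  have one: "\<one>\<^bsub>F\<^esub> \<in> ?S" by (rule subgroup.one_closed[OF sub])
  have T: "\<one>\<^bsub>F\<^esub> \<in> ?T" "?T \<subseteq> carrier F"
    using one by (auto simp: kernel_def intro!: G.one_in_iterated_commutator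
        dest!: G.iterated_commutator_subset[THEN subsetD, rotated])
  have coset: "?T #>\<^bsub>F\<^esub> y \<in> carrier (baer_invariant c F \<pi> G)" if "y \<in> ?S" for y
    using that by (auto simp: baer_invariant_def FactGroup_def RCOSETS_def r_coset_def)
  obtain h where "bij_betw h {a} (carrier (baer_invariant c F \<pi> G))"
    using A by (auto simp: is_iso_def iso_def)
  then have "carrier (baer_invariant c F \<pi> G) = {h a}"
    by (simp add: bij_betw_def)
  with coset[OF x] coset[OF one] have eq: "?T #>\<^bsub>F\<^esub> x = ?T #>\<^bsub>F\<^esub> \<one>\<^bsub>F\<^esub>"
    by simp
  have "x \<in> carrier F" using x by (simp add: kernel_def)
  then have "x \<in> ?T #>\<^bsub>F\<^esub> x" using T unfolding r_coset_def by force
  also have "?T #>\<^bsub>F\<^esub> x = ?T" using eq T by (simp add: G.coset_mult_one)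
  finally show "x \<in> ?T" .
qed

section \<open>Powers of 1 + X and the test group\<close>

text \<open>\<open>fps_binomial a\<close> is (1 + X)^a, so subtracting 1 leaves aX plus higher
  terms. In the convolution at \<open>Suc i\<close> the term k = 0 dies by the first factor and the
  terms k > 1 by the order of \<open>v\<close>; only k = 1 survives.\<close>

lemma fps_binomial_minus_1_mult_nth:
  fixes v :: "'a :: field_char_0 fps"
  assumes "\<And>j. j < i \<Longrightarrow> v $ j = 0"
  shows "j \<le> i \<Longrightarrow> ((fps_binomial a - 1) * v) $ j = 0"
    and "((fps_binomial a - 1) * v) $ Suc i = a * v $ i"
proof -
  have b: "(fps_binomial a - 1) $ 0 = 0" "(fps_binomial a - 1) $ 1 = a"
    by simp_all
  show "((fps_binomial a - 1) * v) $ j = 0" if "j \<le> i"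
    unfolding fps_mult_nth
  proof (rule sum.neutral, rule ballI)
    fix k assume "k \<in> {0..j}"
    then show "(fps_binomial a - 1) $ k * v $ (j - k) = 0"
      using that assms[of "j - k"] b by (cases k) auto
  qed
  have "((fps_binomial a - 1) * v) $ Suc i = (\<Sum>k = 0..Suc i. if k = 1 then a * v $ i else 0)"
    unfolding fps_mult_nth
  proof (rule sum.cong)
    fix k assume "k \<in> {0..Suc i}"
    then show "(fps_binomial a - 1) $ k * v $ (Suc i - k) = (if k = 1 then a * v $ i else 0)"
      using assms[of "Suc i - k"] b by (cases "k = 0"; cases "k = 1") auto
  qed simp
  then show "((fps_binomial a - 1) * v) $ Suc i = a * v $ i"
    by simp
qed

text \<open>The semidirect product of the integers with the power series of integral constant term, on
  which \<open>k\<close> acts as multiplication by $(1+X)^k$. Rational coefficients are only there to make the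
  library's binomial series available for negative \<open>k\<close>.\<close>

definition series_group :: "(int \<times> rat fps) monoid" where
  "series_group = \<lparr>carrier = {(k, v). v $ 0 \<in> \<int>},
     monoid.mult = (\<lambda>(k, v) (l, w). (k + l, v + fps_binomial (of_int k) * w)),
     one = (0, 0)\<rparr>"

lemma series_group_simps [simp]:
  "(k, v) \<in> carrier series_group \<longleftrightarrow> v $ 0 \<in> \<int>"
  "(k, v) \<otimes>\<^bsub>series_group\<^esub> (l, w) = (k + l, v + fps_binomial (of_int k) * w)"
  "\<one>\<^bsub>series_group\<^esub> = (0, 0)"
  by (simp_all add: series_group_def)

lemma group_series_group: "group series_group"
proof (rule groupI)
  fix x y z
  assume xyz: "x \<in> carrier series_group" "y \<in> carrier series_group" "z \<in> carrier series_group"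
  show "x \<otimes>\<^bsub>series_group\<^esub> y \<otimes>\<^bsub>series_group\<^esub> z = x \<otimes>\<^bsub>series_group\<^esub> (y \<otimes>\<^bsub>series_group\<^esub> z)"
    by (cases x; cases y; cases z) (simp add: fps_binomial_add_mult algebra_simps)
next
  fix x assume x: "x \<in> carrier series_group"
  obtain k v where kv: "x = (k, v)" by fastforce
  show "\<exists>y \<in> carrier series_group. y \<otimes>\<^bsub>series_group\<^esub> x = \<one>\<^bsub>series_group\<^esub>"
    using x kv by (intro bexI[of _ "(- k, - fps_binomial (of_int (- k)) * v)"]) auto
qed auto

lemma inv_series_group:
  assumes "v $ 0 \<in> \<int>"
  shows "inv\<^bsub>series_group\<^esub> (k, v) = (- k, - (fps_binomial (of_int (- k)) * v))"
  using assms by (intro group.inv_equality group_series_group) auto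

lemma series_group_commutator:
  assumes "v $ 0 \<in> \<int>" "w $ 0 \<in> \<int>"
  shows "(k, v) \<otimes>\<^bsub>series_group\<^esub> (l, w) \<otimes>\<^bsub>series_group\<^esub> inv\<^bsub>series_group\<^esub> (k, v)
           \<otimes>\<^bsub>series_group\<^esub> inv\<^bsub>series_group\<^esub> (l, w) =
         (0, (fps_binomial (of_int k) - 1) * w - (fps_binomial (of_int l) - 1) * v)"
proof -
  \<comment> \<open>In the expanded product the exponent k + l acts on the series of the inverse of
    (k, v), and l on that of the inverse of (l, w). These two identities collapse the resulting
    powers of 1 + X.\<close>
  have "fps_binomial (- of_int k) * fps_binomial (of_int k + of_int l) =
      (fps_binomial (of_int l) :: rat fps)"
    by (simp flip: fps_binomial_add_mult)
  moreover have "fps_binomial (of_int l) * fps_binomial (- of_int l) = (1 :: rat fps)"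
    by (simp flip: fps_binomial_add_mult)
  ultimately show ?thesis
    using assms by (simp add: inv_series_group algebra_simps)
qed

text \<open>One formula covers two situations. For i = 0 both terms of the commutator contribute to
  the linear coefficient; for i > 0 the assumption gives k = 0, which removes the term in
  \<open>w\<close>, and the other term has its order raised by one.\<close>

lemma series_group_commutator_nth:
  assumes "v $ 0 \<in> \<int>" "w $ 0 \<in> \<int>" "0 < i \<longrightarrow> k = 0" "\<forall>j<i. v $ j = 0"
  obtains u where
    "(k, v) \<otimes>\<^bsub>series_group\<^esub> (l, w) \<otimes>\<^bsub>series_group\<^esub> inv\<^bsub>series_group\<^esub> (k, v)
       \<otimes>\<^bsub>series_group\<^esub> inv\<^bsub>series_group\<^esub> (l, w) = (0, u)"
    "\<And>j. j < Suc i \<Longrightarrow> u $ j = 0"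
    "u $ Suc i = of_int k * w $ 0 - of_int l * v $ i"
proof
  let ?u = "(fps_binomial (of_int k) - 1) * w - (fps_binomial (of_int l) - 1) * v"
  show "(k, v) \<otimes>\<^bsub>series_group\<^esub> (l, w) \<otimes>\<^bsub>series_group\<^esub> inv\<^bsub>series_group\<^esub> (k, v)
       \<otimes>\<^bsub>series_group\<^esub> inv\<^bsub>series_group\<^esub> (l, w) = (0, ?u)"
    by (rule series_group_commutator[OF assms(1,2)])
  show "?u $ j = 0" if "j < Suc i" for j
    using that assms(3) fps_binomial_minus_1_mult_nth(1)[of i v j "of_int l"] assms(4)
      fps_binomial_minus_1_mult_nth(1)[of 0 w 0 "of_int k"]
    by (cases "i = 0") auto
  show "?u $ Suc i = of_int k * w $ 0 - of_int l * v $ i"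
    using assms(3) fps_binomial_minus_1_mult_nth(2)[of i v "of_int l"] assms(4)
      fps_binomial_minus_1_mult_nth(2)[of 0 w "of_int k"]
    by (cases "i = 0") auto
qed

section \<open>Filtration of the test group by the order in X\<close>

text \<open>Layer i is the target for the image of [R, _i F]. Layer 0 consists of the pairs with k
  and v_0 both zero modulo \<open>d\<close>. Coefficients beyond X^i stay arbitrary rationals, since
  only the leading one is compared in the end.\<close>

definition series_layer :: "int \<Rightarrow> nat \<Rightarrow> (int \<times> rat fps) set" where
  "series_layer d i = {(k, v). d dvd k \<and> (0 < i \<longrightarrow> k = 0) \<and> (\<forall>j<i. v $ j = 0) \<and>
     (\<exists>n. v $ i = of_int n \<and> d dvd n)}"

lemma series_layer_constant_term:
  "(k, v) \<in> series_layer d i \<Longrightarrow> v $ 0 \<in> \<int>"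
  by (cases "i = 0") (auto simp: series_layer_def)

text \<open>Since (1 + X)^a is 1 modulo X, it alters a series of order at least i only beyond X^i.
  Hence the coefficient tracked by \<open>series_layer\<close> is additive under the twisted
  multiplication.\<close>

lemma fps_binomial_mult_nth:
  fixes v :: "'a :: field_char_0 fps"
  assumes "\<And>j. j < i \<Longrightarrow> v $ j = 0" "j \<le> i"
  shows "(fps_binomial a * v) $ j = v $ j"
  using fps_binomial_minus_1_mult_nth(1)[of i v j a] assms by (simp add: left_diff_distrib)

lemma subgroup_series_layer: "subgroup (series_layer d i) series_group"
proof
  show "series_layer d i \<subseteq> carrier series_group"
    using series_layer_constant_term by auto
  show "\<one>\<^bsub>series_group\<^esub> \<in> series_layer d i"
    by (auto simp: series_layer_def intro: exI[of _ 0])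
next
  fix x y assume x: "x \<in> series_layer d i" and y: "y \<in> series_layer d i"
  obtain k v l w where eq: "x = (k, v)" "y = (l, w)" by fastforce
  obtain m n where mn: "v $ i = of_int m" "d dvd m" "w $ i = of_int n" "d dvd n"
    using x y eq by (auto simp: series_layer_def)
  have "(fps_binomial (of_int k) * w) $ j = w $ j" if "j \<le> i" for j
    using y that eq by (intro fps_binomial_mult_nth[of i]) (auto simp: series_layer_def)
  then show "x \<otimes>\<^bsub>series_group\<^esub> y \<in> series_layer d i"
    using x y mn unfolding eq by (auto simp: series_layer_def intro!: exI[of _ "m + n"])
next
  fix x assume x: "x \<in> series_layer d i"
  obtain k v where eq: "x = (k, v)" by fastforce
  obtain m where m: "v $ i = of_int m" "d dvd m"
    using x eq by (auto simp: series_layer_def)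
  have "(fps_binomial (of_int (- k)) * v) $ j = v $ j" if "j \<le> i" for j
    using x that eq by (intro fps_binomial_mult_nth[of i]) (auto simp: series_layer_def)
  then show "inv\<^bsub>series_group\<^esub> x \<in> series_layer d i"
    using x m inv_series_group[OF series_layer_constant_term[OF x[unfolded eq]]] unfolding eq
    by (auto simp: series_layer_def intro!: exI[of _ "- m"])
qed

lemma series_layer_commutator:
  assumes "x \<in> series_layer d i" "y \<in> carrier series_group"
  shows "x \<otimes>\<^bsub>series_group\<^esub> y \<otimes>\<^bsub>series_group\<^esub> inv\<^bsub>series_group\<^esub> x
           \<otimes>\<^bsub>series_group\<^esub> inv\<^bsub>series_group\<^esub> y \<in> series_layer d (Suc i)"
proof -
  obtain k v l w where eq: "x = (k, v)" "y = (l, w)" by fastforce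
  obtain m where m: "v $ i = of_int m" "d dvd m"
    using assms eq by (auto simp: series_layer_def)
  obtain n where n: "w $ 0 = of_int n"
    using assms eq by (auto elim: Ints_cases)
  have k: "d dvd k" "0 < i \<longrightarrow> k = 0" and v: "\<forall>j<i. v $ j = 0"
    using assms eq by (auto simp: series_layer_def)
  have "v $ 0 \<in> \<int>" "w $ 0 \<in> \<int>"
    using assms series_layer_constant_term eq by auto
  from series_group_commutator_nth[OF this k(2) v, of l] obtain u where
    u: "x \<otimes>\<^bsub>series_group\<^esub> y \<otimes>\<^bsub>series_group\<^esub> inv\<^bsub>series_group\<^esub> x
          \<otimes>\<^bsub>series_group\<^esub> inv\<^bsub>series_group\<^esub> y = (0, u)"
       "\<And>j. j < Suc i \<Longrightarrow> u $ j = 0" "u $ Suc i = of_int k * w $ 0 - of_int l * v $ i"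
    unfolding eq by blast
  \<comment> \<open>The leading coefficient is k * n - l * m, where \<open>d\<close> divides both k
    and m.\<close>
  obtain p where "u $ Suc i = of_int p" "d dvd p"
    using u(3) m n k(1) by (intro that[of "k * n - l * m"]) auto
  then show ?thesis
    using u(2) unfolding u(1) by (auto simp: series_layer_def)
qed

lemma (in group_hom) subgroup_preimage:
  assumes "subgroup N H"
  shows "subgroup {x \<in> carrier G. h x \<in> N} G"
  using assms
  by unfold_locales (auto simp: subgroup.m_closed subgroup.one_closed subgroup.m_inv_closed)

lemma iterated_commutator_series_layer:
  assumes "group F" "\<phi> \<in> hom F series_group" "R \<subseteq> carrier F" "\<phi> ` R \<subseteq> series_layer d 0"
  shows "\<phi> ` iterated_commutator F R i \<subseteq> series_layer d i"
proof (induction i)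
  case 0
  show ?case using assms(4) by simp
next
  case (Suc i)
  interpret group_hom F series_group \<phi>
    using assms group_series_group by (simp add: group_hom_def group_hom_axioms_def)
  have sub: "iterated_commutator F R i \<subseteq> carrier F"
    by (rule G.iterated_commutator_subset[OF assms(3)])
  \<comment> \<open>The preimage of a layer is a subgroup, so it is enough to place the generating
    commutators in it.\<close>
  have "iterated_commutator F R (Suc i) \<subseteq> {x \<in> carrier F. \<phi> x \<in> series_layer d (Suc i)}"
    unfolding iterated_commutator.simps
  proof (intro G.commutator_subgroup_minimal subgroup_preimage subgroup_series_layer)
    fix x y assume x: "x \<in> iterated_commutator F R i" and y: "y \<in> carrier F"
    have xF: "x \<in> carrier F" using x sub by blast
    have "\<phi> x \<in> series_layer d i" using x Suc by blast
    from series_layer_commutator[OF this, of "\<phi> y"] xF y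
    show "x \<otimes>\<^bsub>F\<^esub> y \<otimes>\<^bsub>F\<^esub> inv\<^bsub>F\<^esub> x \<otimes>\<^bsub>F\<^esub> inv\<^bsub>F\<^esub> y \<in> {x \<in> carrier F. \<phi> x \<in> series_layer d (Suc i)}"
      by (simp add: G.commutator_closed)
  qed
  then show ?case by auto
qed

section \<open>Engel commutators and their leading coefficients\<close>

primrec engel_commutator :: "('a, 'b) monoid_scheme \<Rightarrow> 'a \<Rightarrow> 'a \<Rightarrow> nat \<Rightarrow> 'a" where
  "engel_commutator G a b 0 = a"
| "engel_commutator G a b (Suc i) =
     engel_commutator G a b i \<otimes>\<^bsub>G\<^esub> b \<otimes>\<^bsub>G\<^esub> inv\<^bsub>G\<^esub> (engel_commutator G a b i) \<otimes>\<^bsub>G\<^esub> inv\<^bsub>G\<^esub> b"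

lemma engel_commutator_lower_central:
  assumes "a \<in> carrier G" "b \<in> carrier G"
  shows "engel_commutator G a b i \<in> lower_central G (Suc i)"
  using assms by (induction i) (auto intro: commutator_in_commutator_subgroup)

text \<open>Each commutator with \<open>b\<close> turns the leading coefficient m into k * n - l *
  m, which is -l * m modulo \<open>d\<close> because \<open>d\<close> divides k. As l is a unit
  modulo \<open>d\<close>, coprimality to \<open>d\<close> persists.\<close>

lemma engel_commutator_series:
  assumes F: "group F" "\<phi> \<in> hom F series_group" and ab: "a \<in> carrier F" "b \<in> carrier F"
    and a: "\<phi> a = (k, v)" "d dvd k" "v $ 0 = of_int m" "coprime m d"
    and b: "\<phi> b = (l, w)" "coprime l d" "w $ 0 = of_int n"
  shows "\<exists>k v m. \<phi> (engel_commutator F a b i) = (k, v) \<and> d dvd k \<and> (0 < i \<longrightarrow> k = 0) \<and>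
           (\<forall>j<i. v $ j = 0) \<and> v $ i = of_int m \<and> coprime m d"
proof (induction i)
  case 0
  show ?case using a by auto
next
  case (Suc i)
  interpret group_hom F series_group \<phi>
    using F group_series_group by (simp add: group_hom_def group_hom_axioms_def)
  let ?e = "engel_commutator F a b i"
  have e: "?e \<in> carrier F"
    using engel_commutator_lower_central[OF ab] G.lower_central_subset by blast
  obtain k v m where IH: "\<phi> ?e = (k, v)" "d dvd k" "0 < i \<longrightarrow> k = 0"
      "\<forall>j<i. v $ j = 0" "v $ i = of_int m" "coprime m d"
    using Suc.IH by blast
  have "v $ 0 \<in> \<int>" "w $ 0 \<in> \<int>"
    using hom_closed[OF e] IH(1) b(3) by auto
  from series_group_commutator_nth[OF this IH(3,4), of l] obtain u where
    u: "\<phi> ?e \<otimes>\<^bsub>series_group\<^esub> \<phi> b \<otimes>\<^bsub>series_group\<^esub> inv\<^bsub>series_group\<^esub> \<phi> ?e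
          \<otimes>\<^bsub>series_group\<^esub> inv\<^bsub>series_group\<^esub> \<phi> b = (0, u)"
       "\<And>j. j < Suc i \<Longrightarrow> u $ j = 0" "u $ Suc i = of_int k * w $ 0 - of_int l * v $ i"
    unfolding IH(1) b(1) by blast
  have "\<phi> (engel_commutator F a b (Suc i)) = (0, u)"
    using u(1) e ab by (simp add: G.commutator_closed)
  moreover have "u $ Suc i = of_int (k * n - l * m)"
    using u(3) IH(5) b(3) by simp
  moreover have "coprime (k * n - l * m) d"
  proof -
    obtain q where "k = d * q" using IH(2) by blast
    \<comment> \<open>Dropping the multiple k * n = d * (q * n) does not change the gcd with
      \<open>d\<close>.\<close>
    then have "gcd (k * n - l * m) d = gcd (- (l * m)) d"
      using gcd_add_mult[of d "q * n" "- (l * m)"] by (simp add: gcd.commute algebra_simps)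
    then show ?thesis
      using b(2) IH(6) by (simp add: coprime_iff_gcd_eq_1[symmetric])
  qed
  ultimately show ?case
    using u(2) by (intro exI[of _ 0] exI[of _ u] exI[of _ "k * n - l * m"]) auto
qed

section \<open>Lifting a free presentation to the test group\<close>

text \<open>Freeness yields \<open>\<phi>\<close> from its values on the basis. The congruences
  spread from the basis to all of \<open>F\<close> because both sides, reduced modulo
  \<open>d\<close>, are homomorphisms into Z_d x Z_d: for \<open>\<pi>\<close> since
  \<open>d\<close> divides \<open>r\<close> and \<open>s\<close>, for \<open>\<phi>\<close> since (1
  + X)^k has constant term 1.\<close>

lemma free_group_lift_series_group:
  assumes pres: "free_presentation F \<pi> (integer_mod_group r \<times>\<times> integer_mod_group s)"
    and "0 < d" "d dvd r" "d dvd s"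
  obtains \<phi> where "\<phi> \<in> hom F series_group"
    "\<And>a. a \<in> carrier F \<Longrightarrow> \<exists>k v n. \<phi> a = (k, v) \<and> v $ 0 = of_int n \<and>
       [k = fst (\<pi> a)] (mod int d) \<and> [n = snd (\<pi> a)] (mod int d)"
proof -
  let ?G = "integer_mod_group r \<times>\<times> integer_mod_group s"
  let ?H = "integer_mod_group d \<times>\<times> integer_mod_group d"
  obtain X where X: "free_on F X" and \<pi>: "\<pi> \<in> hom F ?G"
    using pres by (auto simp: free_presentation_def free_group_def epi_def)
  have XF: "X \<subseteq> carrier F" using X by (simp add: free_on_def)
  define f :: "'a \<Rightarrow> int \<times> rat fps" where
    "f = (\<lambda>x. (fst (\<pi> x), fps_const (of_int (snd (\<pi> x)))))"
  have "f \<in> X \<rightarrow> carrier series_group" by (auto simp: f_def)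
  from free_on_universal(1)[OF X group_series_group this] obtain \<phi>
    where \<phi>: "\<phi> \<in> hom F series_group" and \<phi>X: "\<forall>x \<in> X. \<phi> x = f x" by blast
  define g where "g = (\<lambda>a. (fst (\<pi> a) mod int d, snd (\<pi> a) mod int d))"
  \<comment> \<open>The floor only converts type: the constant term is an integer on the image of
    \<open>\<phi>\<close>.\<close>
  define h where "h = (\<lambda>a. (fst (\<phi> a) mod int d, \<lfloor>snd (\<phi> a) $ 0\<rfloor> mod int d))"
  have \<phi>_const: "snd (\<phi> a) $ 0 \<in> \<int>" if "a \<in> carrier F" for a
    using hom_in_carrier[OF \<phi> that] by (cases "\<phi> a") simp
  have "g \<in> hom F ?H"
  proof (rule homI)
    fix a b assume ab: "a \<in> carrier F" "b \<in> carrier F"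
    have "int d dvd int r" "int d dvd int s" using assms by auto
    then show "g (a \<otimes>\<^bsub>F\<^esub> b) = g a \<otimes>\<^bsub>?H\<^esub> g b"
      using hom_mult[OF \<pi> ab]
      by (cases "\<pi> a"; cases "\<pi> b") (simp add: g_def mod_mod_cancel mod_simps)
  qed (use \<open>0 < d\<close> in \<open>simp add: g_def carrier_integer_mod_group\<close>)
  moreover have "h \<in> hom F ?H"
  proof (rule homI)
    fix a b assume ab: "a \<in> carrier F" "b \<in> carrier F"
    have "snd (\<phi> a) $ 0 \<in> \<int>" "snd (\<phi> b) $ 0 \<in> \<int>" using ab \<phi>_const by auto
    then show "h (a \<otimes>\<^bsub>F\<^esub> b) = h a \<otimes>\<^bsub>?H\<^esub> h b"
      using hom_mult[OF \<phi> ab]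
      by (cases "\<phi> a"; cases "\<phi> b") (auto simp: h_def mod_simps elim!: Ints_cases)
  qed (use \<open>0 < d\<close> in \<open>simp add: h_def carrier_integer_mod_group\<close>)
  moreover have "\<forall>x \<in> X. h x = g x"
    using \<phi>X by (simp add: f_def g_def h_def)
  moreover have "group ?H" by (simp add: DirProd_group)
  moreover have "g \<in> X \<rightarrow> carrier ?H"
    using \<open>0 < d\<close> by (simp add: g_def carrier_integer_mod_group)
  ultimately have hg: "h a = g a" if "a \<in> carrier F" for a
    using free_on_universal(2)[OF X, of ?H g h g a] that by blast
  show thesis
  proof (rule that[OF \<phi>])
    fix a assume a: "a \<in> carrier F"
    obtain n where "snd (\<phi> a) $ 0 = of_int n"
      using \<phi>_const[OF a] by (auto elim: Ints_cases)
    then show "\<exists>k v n. \<phi> a = (k, v) \<and> v $ 0 = of_int n \<and>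
       [k = fst (\<pi> a)] (mod int d) \<and> [n = snd (\<pi> a)] (mod int d)"
      using hg[OF a] by (cases "\<phi> a") (auto simp: g_def h_def cong_def)
  qed
qed

section \<open>The separating element and the non-existence of covers\<close>

lemma lower_central_not_subset_iterated_commutator:
  assumes pres: "free_presentation F \<pi> G" and G: "G = integer_mod_group r \<times>\<times> integer_mod_group s"
    and "0 < r" "0 < s" "gcd r s \<noteq> 1"
  shows "\<not> lower_central F (Suc c) \<subseteq> iterated_commutator F (kernel F G \<pi>) c"
proof
  let ?d = "gcd r s"
  assume sub: "lower_central F (Suc c) \<subseteq> iterated_commutator F (kernel F G \<pi>) c"
  have F: "group F"
    using pres by (auto simp: free_presentation_def free_group_def free_on_def)
  have \<pi>: "\<pi> ` carrier F = carrier G"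
    using pres by (auto simp: free_presentation_def epi_def)
  have d: "1 < ?d" using assms(3-5) by (metis gcd_eq_0_iff less_one linorder_neqE_nat less_numeral_extra(3))
  then have d0: "0 < ?d" by linarith
  obtain \<phi> where \<phi>: "\<phi> \<in> hom F series_group"
    "\<And>a. a \<in> carrier F \<Longrightarrow> \<exists>k v n. \<phi> a = (k, v) \<and> v $ 0 = of_int n \<and>
       [k = fst (\<pi> a)] (mod int ?d) \<and> [n = snd (\<pi> a)] (mod int ?d)"
    using free_group_lift_series_group[OF pres[unfolded G] d0 gcd_dvd1 gcd_dvd2] by blast
  \<comment> \<open>In a factor of order 1 the carrier is {0}, so this is what makes 1 an element of
    each factor.\<close>
  have "r \<noteq> 1" "s \<noteq> 1" using assms(5) by auto
  then have "(0, 1) \<in> \<pi> ` carrier F" "(1, 0) \<in> \<pi> ` carrier F"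
    unfolding \<pi> G by simp_all
  \<comment> \<open>\<open>a\<close> lies over the second generator and supplies a series with v_0 =
    1 modulo d; \<open>b\<close> lies over the first and supplies the action, with l = 1 modulo
    d.\<close>
  then obtain a b where a: "a \<in> carrier F" "\<pi> a = (0, 1)" and b: "b \<in> carrier F" "\<pi> b = (1, 0)"
    by (metis imageE)
  obtain k v m where ka: "\<phi> a = (k, v)" "v $ 0 = of_int m" "[k = 0] (mod int ?d)" "[m = 1] (mod int ?d)"
    using \<phi>(2)[OF a(1)] a(2) by auto
  obtain l w n where lb: "\<phi> b = (l, w)" "w $ 0 = of_int n" "[l = 1] (mod int ?d)"
    using \<phi>(2)[OF b(1)] b(2) by auto
  have "coprime m (int ?d)" "coprime l (int ?d)" "int ?d dvd k"
    using ka lb by (auto simp: cong_0_iff intro: cong_imp_coprime cong_sym)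
  from engel_commutator_series[OF F \<phi>(1) a(1) b(1) ka(1) this(3) ka(2) this(1) lb(1) this(2) lb(2), of c]
  obtain k v m where e: "\<phi> (engel_commutator F a b c) = (k, v)" "v $ c = of_int m" "coprime m (int ?d)"
    by blast
  have "\<phi> ` kernel F G \<pi> \<subseteq> series_layer (int ?d) 0"
  proof
    fix y assume "y \<in> \<phi> ` kernel F G \<pi>"
    then obtain x where x: "x \<in> carrier F" "\<pi> x = (0, 0)" "y = \<phi> x"
      by (auto simp: kernel_def G)
    then show "y \<in> series_layer (int ?d) 0"
      using \<phi>(2)[OF x(1)] by (auto simp: series_layer_def cong_0_iff)
  qed
  from iterated_commutator_series_layer[OF F \<phi>(1) _ this, of c]
  have "\<phi> (engel_commutator F a b c) \<in> series_layer (int ?d) c"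
    using sub engel_commutator_lower_central[OF a(1) b(1), of c] by (auto simp: kernel_def)
  \<comment> \<open>The coefficient of X^c has both descriptions, so m is at once divisible by d and
    coprime to d, although d > 1.\<close>
  then have "int ?d dvd m" using e by (auto simp: series_layer_def)
  then have "int ?d dvd 1" using e(3) by (metis coprime_common_divisor dvd_refl)
  then show False using d by simp
qed

theorem theorem2:
  fixes r s c :: nat and F :: "'f monoid" and \<pi> :: "'f \<Rightarrow> int \<times> int" and G :: "(int \<times> int) monoid"
  assumes "0 < r" and "0 < s" and "gcd r s \<noteq> 1" and "c \<ge> 2"
    and "G = integer_mod_group r \<times>\<times> integer_mod_group s"
    and "free_presentation F \<pi> G"
  shows "(\<nexists>(A :: 'a monoid) \<iota> (E :: 'e monoid) p. stem_cover c F \<pi> A \<iota> E p G) \<and>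
         (\<nexists>E :: 'e monoid. covering_group c F \<pi> G E)"
proof -
  have F: "group F" and \<pi>: "\<pi> \<in> hom F G"
    using assms(6) by (auto simp: free_presentation_def free_group_def free_on_def epi_def)
  have G: "comm_group G"
    unfolding assms(5)
    by (intro group.group_comm_groupI DirProd_group) (auto simp: add.commute)
  interpret group_hom F G \<pi>
    using F \<pi> G by (simp add: group_hom_def group_hom_axioms_def comm_group_def)
  \<comment> \<open>The types are local to this fact so that it serves both conjuncts:
    \<open>A\<close> on its own type, and \<open>A\<close> on the carrier type of \<open>E\<close>
    as in \<open>covering_group\<close>.\<close>
  have no_cover: False if "stem_cover c F \<pi> A \<iota> E p G"
    for A :: "'x monoid" and \<iota> and E :: "'y monoid" and p
  proof -
    have "A \<cong> baer_invariant c F \<pi> G" using that by (simp add: stem_cover_def)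
    from baer_invariant_trivialD[OF F _ \<pi> this stem_cover_of_abelian_trivial[OF that G assms(4)]]
    have "kernel F G \<pi> \<inter> lower_central F (Suc c) \<subseteq> iterated_commutator F (kernel F G \<pi>) c"
      by simp
    \<comment> \<open>Because \<open>G\<close> is abelian, gamma_{c+1}(F) lies in R, so the
      intersection in the Baer invariant is all of gamma_{c+1}(F).\<close>
    moreover have "lower_central F (Suc c) \<subseteq> kernel F G \<pi>"
      using lower_central_2_subset_kernel[OF G] G.lower_central_subset_2[of "Suc c"] assms(4)
      by auto
    ultimately show False
      using lower_central_not_subset_iterated_commutator[OF assms(6,5,1-3), of c] by blast
  qed
  show ?thesis
    unfolding covering_group_def by (intro conjI notI; elim exE; erule no_cover)
qed

end
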